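(* There does not exist any deeply critical oriented circulant clique of even order; that is, for no even $n$ and no admissible $S\subseteq\mathbb{Z}_n$ is the oriented circulant graph $\overrightarrow{C}(n,S)$ both an absolute oriented clique and deeply critical.
   Context: An oriented graph is a directed graph with no loops and no directed cycles of length two. An oriented $k$-colouring of $\overrightarrow{G}$ is a function $\phi:V(\overrightarrow{G})\to\{1,\dots,k\}$ such that (i) $\phi(x)\neq\phi(y)$ for every arc $xy$, and (ii) for all arcs $xy,uv$, if $\phi(x)=\phi(v)$ then $\phi(y)\neq\phi(u)$. The oriented chromatic number $\chi_o(\overrightarrow{G})$ is the least such $k$. An absolute oriented clique is an oriented graph with $\chi_o(\overrightarrow{G})=|V(\overrightarrow{G})|$. An oriented graph is deeply critical if $\chi_o(\overrightarrow{G}-xy)=\chi_o(\overrightarrow{G})-2$ for every arc $xy$. For an integer $n$ and $S\subseteq\mathbb{Z}_n$ such that for all $k\in\mathbb{Z}_n$, $k\in S$ implies $-k\notin S$ (admissible $S$), the oriented circulant graph $\overrightarrow{C}(n,S)$ has vertex set $\mathbb{Z}_n$ and an arc $ij$ whenever $j-i$ is congruent modulo $n$ to an element of $S$. *)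

theory Defs
  imports "Graph_Theory.Pair_Digraph" "HOL-Number_Theory.Cong"
begin

locale oriented_graph = pair_digraph +
  assumes no_two_cycles: "(x, y) \<in> parcs G \<Longrightarrow> (y, x) \<notin> parcs G"

definition oriented_colouring :: "'a pair_pre_digraph \<Rightarrow> nat \<Rightarrow> ('a \<Rightarrow> nat) \<Rightarrow> bool" where
  "oriented_colouring G k \<phi> \<longleftrightarrow>
     \<phi> ` pverts G \<subseteq> {1..k} \<and>
     (\<forall>(x, y) \<in> parcs G. \<phi> x \<noteq> \<phi> y) \<and>
     (\<forall>(x, y) \<in> parcs G. \<forall>(u, v) \<in> parcs G. \<phi> x = \<phi> v \<longrightarrow> \<phi> y \<noteq> \<phi> u)"

definition oriented_chromatic_number :: "'a pair_pre_digraph \<Rightarrow> nat" where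
  "oriented_chromatic_number G = (LEAST k. \<exists>\<phi>. oriented_colouring G k \<phi>)"

definition absolute_oriented_clique :: "'a pair_pre_digraph \<Rightarrow> bool" where
  "absolute_oriented_clique G \<longleftrightarrow>
     oriented_graph G \<and> oriented_chromatic_number G = card (pverts G)"

definition delete_arc :: "'a pair_pre_digraph \<Rightarrow> 'a \<times> 'a \<Rightarrow> 'a pair_pre_digraph" where
  "delete_arc G e = G\<lparr>parcs := parcs G - {e}\<rparr>"

definition deeply_critical :: "'a pair_pre_digraph \<Rightarrow> bool" where
  "deeply_critical G \<longleftrightarrow>
     oriented_graph G \<and>
     (\<forall>e \<in> parcs G.
        int (oriented_chromatic_number (delete_arc G e)) = int (oriented_chromatic_number G) - 2)"

text \<open>The elements of $Z_n$ are represented by the integers in \<open>{0..<n}\<close>, for \<open>n > 0\<close>.\<close>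

definition admissible :: "int \<Rightarrow> int set \<Rightarrow> bool" where
  "admissible n S \<longleftrightarrow> S \<subseteq> {0..<n} \<and> (\<forall>k \<in> {0..<n}. k \<in> S \<longrightarrow> (- k) mod n \<notin> S)"

definition oriented_circulant :: "int \<Rightarrow> int set \<Rightarrow> int pair_pre_digraph" where
  "oriented_circulant n S =
     \<lparr> pverts = {0..<n},
       parcs = {(i, j). i \<in> {0..<n} \<and> j \<in> {0..<n} \<and> (\<exists>s \<in> S. [j - i = s] (mod n))} \<rparr>"

text \<open>
  The following facts show that the definitions fit together: admissible sets yield oriented
  graphs, arc deletion preserves them, and the minimum in the oriented chromatic number is attained.
\<close>

lemma oriented_graph_oriented_circulant:
  assumes n: "n > 0" and S: "admissible n S"
  shows "oriented_graph (oriented_circulant n S)"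
proof -
  have sub: "S \<subseteq> {0..<n}" and neg: "\<And>k. k \<in> S \<Longrightarrow> (- k) mod n \<notin> S"
    using S by (auto simp: admissible_def)
  have mod_in: "(j - i) mod n \<in> S" if "s \<in> S" "[j - i = s] (mod n)" for i j s
  proof -
    have "(j - i) mod n = s mod n" using that by (simp add: cong_def)
    moreover have "s mod n = s" using sub that by auto
    ultimately show ?thesis using that by simp
  qed
  have asym: False if "s \<in> S" "[j - i = s] (mod n)" "t \<in> S" "[i - j = t] (mod n)" for i j s t
  proof -
    have "(- ((j - i) mod n)) mod n = (i - j) mod n" by (simp add: mod_minus_eq)
    then show False using neg[OF mod_in[OF that(1,2)]] mod_in[OF that(3,4)] by simp
  qed
  show ?thesis
  proof
    show "finite (parcs (oriented_circulant n S))"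
      by (rule finite_subset[of _ "{0..<n} \<times> {0..<n}"]) (auto simp: oriented_circulant_def)
    show "fst e \<noteq> snd e" if "e \<in> parcs (oriented_circulant n S)" for e
    proof
      assume eq: "fst e = snd e"
      from that obtain s where "s \<in> S" "[snd e - fst e = s] (mod n)"
        by (auto simp: oriented_circulant_def)
      with asym[of s "fst e" "snd e" s] eq show False by simp
    qed
  qed (auto simp: oriented_circulant_def dest: asym)
qed

lemma oriented_graph_delete_arc:
  assumes "oriented_graph G"
  shows "oriented_graph (delete_arc G e)"
proof -
  interpret oriented_graph G by (fact assms)
  show ?thesis
    by unfold_locales
      (use pair_finite_verts pair_finite_arcs arc_fst_in_verts arc_snd_in_verts
         pair_no_loops no_two_cycles in \<open>auto simp: delete_arc_def\<close>)
qed

lemma oriented_chromatic_number_attained: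
  assumes "oriented_graph G"
  shows "\<exists>\<phi>. oriented_colouring G (oriented_chromatic_number G) \<phi>"
proof -
  interpret oriented_graph G by (fact assms)
  obtain f where f: "bij_betw f (pverts G) {1..card (pverts G)}"
    using finite_same_card_bij[OF pair_finite_verts, of "{1..card (pverts G)}"] by auto
  have inj: "f x = f y \<longleftrightarrow> x = y" if "x \<in> pverts G" "y \<in> pverts G" for x y
    using f that by (auto simp: bij_betw_def inj_on_eq_iff)
  have irrefl: "(x, x) \<notin> parcs G" for x
    using no_two_cycles by blast
  have "oriented_colouring G (card (pverts G)) f"
    unfolding oriented_colouring_def
    using f by (auto simp: bij_betw_def inj in_arcsD1 in_arcsD2 irrefl dest: no_two_cycles)
  then show ?thesis
    unfolding oriented_chromatic_number_def
    by (intro LeastI_ex[where P = "\<lambda>k. \<exists>\<phi>. oriented_colouring G k \<phi>"]) blast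
qed

end

theory Submission
  imports Defs
begin

text \<open>
  In an oriented clique any two distinct vertices are joined by a directed path of length one or
  two, so \<open>n / 2 = a + b\<close> in \<open>\<int>\<^sub>n\<close> for some \<open>a, b \<in> S\<close>, since \<open>n / 2\<close> is its own negative.
  Delete the arc from \<open>0\<close> to \<open>a\<close>. A path \<open>-c \<rightarrow> 0 \<rightarrow> a\<close> can be replaced by \<open>-c \<rightarrow> a - c \<rightarrow> a\<close> if
  \<open>c \<noteq> a\<close>, and by the reverse path \<open>a \<rightarrow> a + b \<rightarrow> a + 2 b = -a\<close> if \<open>c = a\<close>. Hence the nonzero
  vertices still need \<open>n - 1\<close> different colours, while deep criticality allows only \<open>n - 2\<close>.
\<close>

definition linked :: "'a pair_pre_digraph \<Rightarrow> 'a \<Rightarrow> 'a \<Rightarrow> bool" where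
  "linked G u v \<longleftrightarrow> (u, v) \<in> parcs G \<or> (\<exists>w. (u, w) \<in> parcs G \<and> (w, v) \<in> parcs G)"

text \<open>On a path \<open>u\<close>, \<open>w\<close>, \<open>v\<close>, condition (ii) applied
  to its two arcs turns equal colours at the ends into the absurdity that \<open>w\<close> differs
  in colour from itself.\<close>

lemma oriented_colouring_linked_neq:
  assumes "oriented_colouring G k \<phi>" and "linked G u v"
  shows "\<phi> u \<noteq> \<phi> v"
  using assms unfolding oriented_colouring_def linked_def by fastforce

text \<open>Identify \<open>v\<close> with \<open>u\<close>. With no directed path of length one or
  two between them, the quotient has no loop and no 2-cycle, so pairwise distinct colours on it give
  a colouring that saves one colour.\<close>

lemma oriented_chromatic_number_less_if_not_linked:
  assumes G: "oriented_graph G" and u: "u \<in> pverts G" and v: "v \<in> pverts G" and "u \<noteq> v"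
    and nl: "\<not> linked G u v" "\<not> linked G v u"
  shows "oriented_chromatic_number G < card (pverts G)"
proof -
  interpret oriented_graph G by (fact G)
  let ?m = "card (pverts G) - 1"
  have "card (pverts G - {v}) = card {1..?m}"
    using v by simp
  then obtain f where f: "bij_betw f (pverts G - {v}) {1..?m}"
    using finite_same_card_bij[of "pverts G - {v}" "{1..?m}"] pair_finite_verts by auto
  define r where "r x = (if x = v then u else x)" for x
  have r_in: "r x \<in> pverts G - {v}" if "x \<in> pverts G" for x
    using that u \<open>u \<noteq> v\<close> by (auto simp: r_def)
  have same: "x = y \<or> x = u \<and> y = v \<or> x = v \<and> y = u"
    if "x \<in> pverts G" "y \<in> pverts G" "f (r x) = f (r y)" for x y
  proof -
    have "r x = r y"
      using f that r_in by (meson bij_betw_imp_inj_on inj_onD)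
    then show ?thesis by (auto simp: r_def split: if_splits)
  qed
  have noloop: "(x, x) \<notin> parcs G" for x
    using no_two_cycles by blast
  have "oriented_colouring G ?m (f \<circ> r)"
    unfolding oriented_colouring_def
  proof (intro conjI)
    show "(f \<circ> r) ` pverts G \<subseteq> {1..?m}"
      using f r_in by (auto simp: bij_betw_def)
    show "\<forall>(x, y)\<in>parcs G. (f \<circ> r) x \<noteq> (f \<circ> r) y"
      using same nl noloop by (auto simp: linked_def dest: in_arcsD1 in_arcsD2)
    \<comment> \<open>If \<open>x = q\<close> and \<open>y = p\<close>, the arcs form a 2-cycle. If
      only one of these equalities holds, they form a path of length two between \<open>u\<close>
      and \<open>v\<close>. If neither holds, each arc is a loop or joins \<open>u\<close> and
      \<open>v\<close>.\<close>
    have "(f \<circ> r) y \<noteq> (f \<circ> r) p"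
      if "(x, y) \<in> parcs G" "(p, q) \<in> parcs G" "(f \<circ> r) x = (f \<circ> r) q" for x y p q
    proof
      assume "(f \<circ> r) y = (f \<circ> r) p"
      then have "y = p \<or> y = u \<and> p = v \<or> y = v \<and> p = u"
        using same that in_arcsD1 in_arcsD2 by (metis comp_apply)
      moreover have "x = q \<or> x = u \<and> q = v \<or> x = v \<and> q = u"
        using same that in_arcsD1 in_arcsD2 by (metis comp_apply)
      ultimately show False
        using that nl noloop no_two_cycles unfolding linked_def by blast
    qed
    then show "\<forall>(x, y)\<in>parcs G. \<forall>(p, q)\<in>parcs G. (f \<circ> r) x = (f \<circ> r) q \<longrightarrow> (f \<circ> r) y \<noteq> (f \<circ> r) p"
      by blast
  qed
  then have "oriented_chromatic_number G \<le> ?m"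
    unfolding oriented_chromatic_number_def by (blast intro: Least_le)
  moreover have "card (pverts G) > 0"
    using v pair_finite_verts card_gt_0_iff by blast
  ultimately show ?thesis by linarith
qed

lemma absolute_oriented_clique_linked:
  assumes "absolute_oriented_clique G" and "u \<in> pverts G" "v \<in> pverts G" "u \<noteq> v"
  shows "linked G u v \<or> linked G v u"
  using oriented_chromatic_number_less_if_not_linked[of G u v] assms
  by (auto simp: absolute_oriented_clique_def)

text \<open>An optimal colouring is injective on \<open>W\<close>, because linked vertices receive
  different colours.\<close>

lemma card_le_oriented_chromatic_number:
  assumes "oriented_graph G" and "W \<subseteq> pverts G"
    and linked: "\<And>u v. u \<in> W \<Longrightarrow> v \<in> W \<Longrightarrow> u \<noteq> v \<Longrightarrow> linked G u v \<or> linked G v u"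
  shows "card W \<le> oriented_chromatic_number G"
proof -
  obtain \<phi> where \<phi>: "oriented_colouring G (oriented_chromatic_number G) \<phi>"
    using oriented_chromatic_number_attained[OF assms(1)] by blast
  have "inj_on \<phi> W"
    using oriented_colouring_linked_neq[OF \<phi>] linked by (metis inj_onI)
  moreover have "\<phi> ` W \<subseteq> {1..oriented_chromatic_number G}"
    using \<phi> assms(2) by (auto simp: oriented_colouring_def)
  ultimately show ?thesis
    using card_inj_on_le[of \<phi> W "{1..oriented_chromatic_number G}"] by simp
qed

text \<open>The elements of \<open>S\<close> are reduced representatives, so being congruent to one
  of them means having it as remainder.\<close>

lemma oriented_circulant_arc_iff:
  assumes "admissible n S"
  shows "(i, j) \<in> parcs (oriented_circulant n S) \<longleftrightarrow>
    i \<in> {0..<n} \<and> j \<in> {0..<n} \<and> (j - i) mod n \<in> S"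
proof -
  have "s mod n = s" if "s \<in> S" for s
    using assms that by (auto simp: admissible_def)
  then have "(\<exists>s\<in>S. [j - i = s] (mod n)) \<longleftrightarrow> (j - i) mod n \<in> S"
    by (auto simp: cong_def)
  then show ?thesis by (auto simp: oriented_circulant_def)
qed

theorem theorem4:
  fixes n :: int and S :: "int set"
  assumes "n > 0" and "even n" and "admissible n S"
  shows "\<not> (absolute_oriented_clique (oriented_circulant n S) \<and>
            deeply_critical (oriented_circulant n S))"
proof
  let ?G = "oriented_circulant n S"
  assume "absolute_oriented_clique ?G \<and> deeply_critical ?G"
  then have clique: "absolute_oriented_clique ?G" and crit: "deeply_critical ?G"
    by auto
  interpret oriented_graph ?G
    using assms by (intro oriented_graph_oriented_circulant)
  note arc = oriented_circulant_arc_iff[OF assms(3)]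
  have verts: "pverts ?G = {0..<n}"
    by (simp add: oriented_circulant_def)
  obtain h where n_eq: "n = 2 * h"
    using assms(2) by blast
  then have h: "0 < h" "h < n"
    using assms(1) by auto
  have S_range: "0 \<le> s" "s < n" if "s \<in> S" for s
    using assms(3) that by (auto simp: admissible_def)
  have S_neg: "(- s) mod n \<notin> S" if "s \<in> S" for s
    using assms(3) that by (auto simp: admissible_def)
  have S_nonzero: "s \<noteq> 0" if "s \<in> S" for s
    using S_neg[OF that] that by auto
  \<comment> \<open>This allows arcs to be written with unreduced integers; \<open>t\<close>
    accounts for wrapping around modulo \<open>n\<close>.\<close>
  have arcI: "(i mod n, j mod n) \<in> parcs ?G" if "s \<in> S" "j - i = s + t * n" for i j s t
  proof -
    have "(j mod n - i mod n) mod n = s"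
      using that S_range by (simp add: mod_diff_eq)
    then show ?thesis using that(1) assms(1) by (simp add: arc)
  qed
  have "(- h) mod n = h"
    using h n_eq mod_add_self2[of "- h" n] by simp
  then have "h \<notin> S"
    using S_neg by metis
  \<comment> \<open>As \<open>h \<notin> S\<close>, the link between \<open>0\<close> and
    \<open>h\<close> has length two, and \<open>a\<close>, \<open>b\<close> are the differences
    along it. A path from \<open>h\<close> to \<open>0\<close> serves equally well: its differences
    add up to \<open>-h\<close>, which is \<open>h\<close> modulo \<open>n\<close>.\<close>
  obtain a b where a: "a \<in> S" and b: "b \<in> S" and ab: "(a + b) mod n = h"
  proof -
    have "linked ?G 0 h \<or> linked ?G h 0"
      by (rule absolute_oriented_clique_linked[OF clique]) (use h in \<open>simp_all add: verts\<close>)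
    then show ?thesis
    proof
      assume "linked ?G 0 h"
      then obtain w where "w mod n \<in> S" "(h - w) mod n \<in> S"
        using \<open>h \<notin> S\<close> h by (auto simp: linked_def arc)
      moreover have "(w mod n + (h - w) mod n) mod n = h"
        using h by (simp add: mod_add_eq)
      ultimately show ?thesis using that by blast
    next
      assume "linked ?G h 0"
      then obtain w where "(w - h) mod n \<in> S" "(- w) mod n \<in> S"
        using \<open>h \<notin> S\<close> \<open>(- h) mod n = h\<close> by (auto simp: linked_def arc)
      moreover have "((w - h) mod n + (- w) mod n) mod n = h"
        using \<open>(- h) mod n = h\<close> by (simp add: mod_add_eq)
      ultimately show ?thesis using that by blast
    qed
  qed
  let ?D = "delete_arc ?G (0, a)"
  have arc_D: "e \<in> parcs ?D \<longleftrightarrow> e \<in> parcs ?G \<and> e \<noteq> (0, a)" for e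
    by (auto simp: delete_arc_def)
  have bypass: "linked ?D u a \<or> linked ?D a u"
    if "u \<noteq> 0" and u: "(u, 0) \<in> parcs ?G" for u
  proof -
    define c where "c = (- u) mod n"
    have "c \<in> S" "0 \<le> u" "u < n"
      using u by (auto simp: arc c_def)
    then have u_eq: "u = n - c"
      using \<open>u \<noteq> 0\<close> by (simp add: c_def zmod_zminus1_eq_if)
    show ?thesis
    proof (cases "c = a")
      case False
      have "(u mod n, (a - c) mod n) \<in> parcs ?G"
        using arcI[of a "a - c" u "-1"] a by (simp add: u_eq)
      moreover have "((a - c) mod n, a mod n) \<in> parcs ?G"
        using arcI[of c a "a - c" 0] \<open>c \<in> S\<close> by simp
      \<comment> \<open>The detour must avoid \<open>(0, a)\<close>. Its first arc starts at
        \<open>u \<noteq> 0\<close>; its second arc ends at \<open>a\<close>, so its start has to be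
        nonzero, which is where \<open>c \<noteq> a\<close> enters.\<close>
      moreover have "(a - c) mod n \<noteq> 0"
      proof
        assume "(a - c) mod n = 0"
        then have "a mod n = c mod n" by (simp add: mod_eq_dvd_iff mod_eq_0_iff_dvd)
        then show False using False S_range a \<open>c \<in> S\<close> by simp
      qed
      ultimately have "linked ?D u a"
        using \<open>u \<noteq> 0\<close> \<open>0 \<le> u\<close> \<open>u < n\<close> S_range[OF a] by (auto simp: linked_def arc_D)
      then show ?thesis ..
    next
      case True
      define q where "q = (a + b) div n"
      have q: "a + b = q * n + h"
        using ab by (metis div_mult_mod_eq q_def)
      have "(a mod n, (a + b) mod n) \<in> parcs ?G"
        using arcI[of b "a + b" a 0] b by simp
      \<comment> \<open>Here \<open>u = n - a\<close>, so the difference is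
        \<open>b + n - 2 * (a + b)\<close>, and \<open>2 * h = n\<close> leaves only a multiple of
        \<open>n\<close> besides \<open>b\<close>.\<close>
      moreover have "u - (a + b) = b + (- 2 * q) * n"
        using q True u_eq n_eq by (simp add: algebra_simps)
      then have "((a + b) mod n, u mod n) \<in> parcs ?G"
        using arcI b by blast
      ultimately have "linked ?D a u"
        using \<open>0 \<le> u\<close> \<open>u < n\<close> S_range[OF a] S_nonzero[OF a] ab h
        by (auto simp: linked_def arc_D)
      then show ?thesis ..
    qed
  qed
  \<comment> \<open>A path of length at most two with nonzero ends can use \<open>(0, a)\<close>
    only as its second arc; then \<open>v = a\<close> and \<open>u\<close> is an in-neighbour of
    \<open>0\<close>, as in \<open>bypass\<close>.\<close>
  have survive: "linked ?D u v \<or> linked ?D v u" if "linked ?G u v" "u \<noteq> 0" "v \<noteq> 0" for u v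
    using that bypass by (auto simp: linked_def arc_D)
  \<comment> \<open>The vertex \<open>0\<close> is left out because the deletion may unlink it from
    \<open>a\<close>.\<close>
  have "card {1..<n} \<le> oriented_chromatic_number ?D"
  proof (rule card_le_oriented_chromatic_number)
    show "oriented_graph ?D"
      by (intro oriented_graph_delete_arc) unfold_locales
    show "{1..<n} \<subseteq> pverts ?D"
      by (auto simp: delete_arc_def verts)
    fix u v
    assume "u \<in> {1..<n}" "v \<in> {1..<n}" "u \<noteq> v"
    then have "linked ?G u v \<or> linked ?G v u" and "u \<noteq> 0" "v \<noteq> 0"
      using absolute_oriented_clique_linked[OF clique, of u v] by (auto simp: verts)
    then show "linked ?D u v \<or> linked ?D v u"
      using survive by blast
  qed
  moreover have "(0, a) \<in> parcs ?G"
    using S_range[OF a] a by (simp add: arc)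
  then have "int (oriented_chromatic_number ?D) = n - 2"
    using crit clique assms(1)
    by (simp add: deeply_critical_def absolute_oriented_clique_def verts)
  ultimately show False
    using assms(1) by simp
qed

end
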